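(* Let $G$ be a graph with $m\ge 1$ edges and minimum degree $\delta$, and let $\alpha>0$ be real. Then $$SDD_\alpha(G)\ge 2\,\delta^{2\alpha}\,m\,\bigl(NK^*(G)\bigr)^{-\alpha/m},$$ and equality is attained if and only if $G$ is a regular graph.
   Context: Graphs are finite, simple and undirected. For a graph $G$ with vertex set $V(G)$ and edge set $E(G)$, $d_u$ denotes the degree of the vertex $u$, and $uv$ denotes the edge joining $u$ and $v$. For $\alpha\in\mathbb{R}$, the variable symmetric division deg index is $$SDD_\alpha(G)=\sum_{uv\in E(G)}\left(\frac{d_u^\alpha}{d_v^\alpha}+\frac{d_v^\alpha}{d_u^\alpha}\right).$$ The modified Narumi-Katayama index is $$NK^*(G)=\prod_{u\in V(G)}d_u^{d_u}=\prod_{uv\in E(G)}d_ud_v$$ (with $0^0=1$). A graph is regular if all its vertices have the same degree. *)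

theory Defs
  imports Complex_Main
begin

definition simple_graph :: "'a set \<Rightarrow> 'a set set \<Rightarrow> bool" where
  "simple_graph V E \<longleftrightarrow> finite V \<and> (\<forall>e\<in>E. e \<subseteq> V \<and> card e = 2)"

definition vdegree :: "'a set set \<Rightarrow> 'a \<Rightarrow> nat" where
  "vdegree E u = card {e \<in> E. u \<in> e}"

definition min_degree :: "'a set \<Rightarrow> 'a set set \<Rightarrow> nat" where
  "min_degree V E = Min (vdegree E ` V)"

definition regular_graph :: "'a set \<Rightarrow> 'a set set \<Rightarrow> bool" where
  "regular_graph V E \<longleftrightarrow> (\<forall>u\<in>V. \<forall>v\<in>V. vdegree E u = vdegree E v)"

(* The inner double sum runs over the two orderings (u, v) of the endpoints of the
   edge e; sdd_edge_term below recovers the usual two-term summand. The base of powr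
   is positive, since endpoints of edges have degree at least 1. *)
definition SDD :: "real \<Rightarrow> 'a set set \<Rightarrow> real" where
  "SDD \<alpha> E = (\<Sum>e\<in>E. \<Sum>u\<in>e. \<Sum>v\<in>e - {u}.
      real (vdegree E u) powr \<alpha> / real (vdegree E v) powr \<alpha>)"

lemma sdd_edge_term:
  fixes f :: "'a \<Rightarrow> 'a \<Rightarrow> real"
  assumes "u \<noteq> v"
  shows "(\<Sum>x\<in>{u, v}. \<Sum>y\<in>{u, v} - {x}. f x y) = f u v + f v u"
proof -
  have "{u, v} - {u} = {v}" "{u, v} - {v} = {u}"
    using assms by auto
  then show ?thesis
    using assms by simp
qed

definition NK_star :: "'a set \<Rightarrow> 'a set set \<Rightarrow> nat" where
  "NK_star V E = (\<Prod>u\<in>V. vdegree E u ^ vdegree E u)"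

end

theory Submission
  imports Defs
begin

text \<open>
  For an edge \<open>uv\<close> put \<open>a = d\<^sub>u\<^sup>\<alpha>\<close>, \<open>b = d\<^sub>v\<^sup>\<alpha>\<close>. Its term \<open>(a\<^sup>2 + b\<^sup>2) / (a b)\<close> is at least
  \<open>2 \<delta>\<^sup>2\<^sup>\<alpha> / (a b)\<close>, with equality only if both endpoints have degree \<open>\<delta>\<close>. The sum of the
  \<open>1 / (a b)\<close> over all edges is then bounded by the AM-GM inequality. If \<open>\<delta> > 0\<close>, every vertex
  lies on an edge, so equality already in the first step forces regularity, and the equality case
  of AM-GM is not required. If \<open>\<delta> = 0\<close>, the right-hand side vanishes, while the graph is not
  regular because it has an edge.
\<close>

text \<open>AM-GM for the numbers \<open>exp (f x)\<close>: the graph of \<open>exp\<close> lies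
  above its tangent at the mean \<open>c\<close>, and the linear terms \<open>f x - c\<close> cancel
  on summation.\<close>

lemma sum_exp_ge_card_mult_exp_mean:
  fixes f :: "'b \<Rightarrow> real"
  assumes "finite A" "A \<noteq> {}"
  shows "real (card A) * exp (sum f A / real (card A)) \<le> (\<Sum>x\<in>A. exp (f x))"
proof -
  define c where "c = sum f A / real (card A)"
  have c: "real (card A) * c = sum f A"
    using assms by (simp add: c_def)
  have "exp c * (1 + (f x - c)) \<le> exp (f x)" for x
  proof -
    have "exp c * (1 + (f x - c)) \<le> exp c * exp (f x - c)"
      by (intro mult_left_mono exp_ge_add_one_self) auto
    then show ?thesis
      by (simp flip: exp_add)
  qed
  then have "(\<Sum>x\<in>A. exp c * (1 + (f x - c))) \<le> (\<Sum>x\<in>A. exp (f x))"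
    by (intro sum_mono)
  moreover have "(\<Sum>x\<in>A. exp c * (1 + (f x - c))) = exp c * real (card A)"
    using c by (simp add: sum.distrib sum_subtractf flip: sum_distrib_left)
  ultimately show ?thesis
    by (simp add: c_def mult.commute)
qed

lemma simple_graph_finite_edges:
  assumes "simple_graph V E"
  shows "finite E"
proof (rule finite_subset)
  show "E \<subseteq> Pow V" "finite (Pow V)"
    using assms by (auto simp: simple_graph_def)
qed

lemma simple_graph_edgeE:
  assumes "simple_graph V E" "e \<in> E"
  obtains u v where "e = {u, v}" "u \<noteq> v" "u \<in> V" "v \<in> V"
proof -
  have "card e = 2" "e \<subseteq> V"
    using assms by (auto simp: simple_graph_def)
  then show thesis
    using that by (auto simp: card_2_iff)
qed

lemma vdegree_pos_iff:
  assumes "finite E"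
  shows "0 < vdegree E u \<longleftrightarrow> (\<exists>e\<in>E. u \<in> e)"
  using assms by (auto simp: vdegree_def card_gt_0_iff)

lemma min_degree_le:
  assumes "finite V" "u \<in> V"
  shows "min_degree V E \<le> vdegree E u"
  using assms by (simp add: min_degree_def)

lemma regular_graph_iff_min_degree:
  assumes "finite V"
  shows "regular_graph V E \<longleftrightarrow> (\<forall>u\<in>V. vdegree E u = min_degree V E)"
\<comment> \<open>\<open>Min\<close> says nothing useful about an empty set, but both sides are then
  vacuously true. Otherwise the minimum is the degree of some vertex.\<close>
proof (cases "V = {}")
  case False
  then have "min_degree V E \<in> vdegree E ` V"
    using assms by (simp add: min_degree_def)
  then obtain w where "w \<in> V" "min_degree V E = vdegree E w"
    by auto
  then show ?thesis
    unfolding regular_graph_def by metis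
qed (simp add: regular_graph_def)

text \<open>Double counting of incident pairs: \<open>f u\<close> occurs once for each edge through
  \<open>u\<close>.\<close>

lemma sum_edges_sum_endpoints:
  fixes f :: "'a \<Rightarrow> 'b::semiring_1"
  assumes "simple_graph V E"
  shows "(\<Sum>e\<in>E. \<Sum>u\<in>e. f u) = (\<Sum>u\<in>V. of_nat (vdegree E u) * f u)"
proof -
  have "(\<Sum>e\<in>E. \<Sum>u\<in>e. f u) = (\<Sum>e\<in>E. \<Sum>u | u \<in> V \<and> u \<in> e. f u)"
    using assms by (intro sum.cong refl) (auto simp: simple_graph_def)
  also have "\<dots> = (\<Sum>u\<in>V. \<Sum>e | e \<in> E \<and> u \<in> e. f u)"
    using assms simple_graph_finite_edges
    by (intro sum.swap_restrict) (auto simp: simple_graph_def)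
  finally show ?thesis
    by (simp add: vdegree_def)
qed

lemma NK_star_pos:
  "0 < NK_star V E"
proof -
  have "0 < n ^ n" for n :: nat
    by (cases n) auto
  then show ?thesis
    by (simp add: NK_star_def prod_pos)
qed

text \<open>Logarithmic form of the passage from the vertex product to the product of
  \<open>d_u d_v\<close> over edges. An isolated vertex contributes \<open>0 ^ 0 = 1\<close> to the
  former and nothing to the latter.\<close>

lemma ln_NK_star:
  assumes "simple_graph V E"
  shows "ln (real (NK_star V E)) = (\<Sum>e\<in>E. \<Sum>u\<in>e. ln (real (vdegree E u)))"
proof -
  have "ln (real (NK_star V E)) = (\<Sum>u\<in>V. ln (real (vdegree E u) ^ vdegree E u))"
    unfolding NK_star_def of_nat_prod of_nat_power
    using assms by (intro ln_prod) (auto simp: simple_graph_def)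
  also have "\<dots> = (\<Sum>u\<in>V. real (vdegree E u) * ln (real (vdegree E u)))"
    by (simp add: ln_realpow)
  finally show ?thesis
    using sum_edges_sum_endpoints[OF assms, of "\<lambda>u. ln (real (vdegree E u))"] by simp
qed

text \<open>Over the common denominator \<open>A * B\<close> the claim becomes
  \<open>2 * D^2 \<le> A^2 + B^2\<close>. Strict monotonicity of the power for
  \<open>\<alpha> > 0\<close> settles equality. The factor \<open>1 / (A * B)\<close> is written as
  an exponential to suit AM-GM.\<close>

lemma powr_ratio_sum_ge:
  fixes a b d \<alpha> :: real
  assumes "0 < d" "d \<le> a" "d \<le> b" "0 < \<alpha>"
  shows "2 * d powr (2 * \<alpha>) * exp (- \<alpha> * (ln a + ln b))
           \<le> a powr \<alpha> / b powr \<alpha> + b powr \<alpha> / a powr \<alpha>" (is "?l \<le> ?r")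
    and "2 * d powr (2 * \<alpha>) * exp (- \<alpha> * (ln a + ln b))
           = a powr \<alpha> / b powr \<alpha> + b powr \<alpha> / a powr \<alpha> \<longleftrightarrow> a = d \<and> b = d"
proof -
  define A B D where "A = a powr \<alpha>" and "B = b powr \<alpha>" and "D = d powr \<alpha>"
  have pos: "0 < D" "0 < A" "0 < B"
    using assms by (auto simp: A_def B_def D_def)
  have le: "D\<^sup>2 \<le> A\<^sup>2" "D\<^sup>2 \<le> B\<^sup>2"
    using assms by (auto simp: A_def B_def D_def intro!: power_mono powr_mono2)
  have powr_eq: "x powr \<alpha> = d powr \<alpha> \<longleftrightarrow> x = d" if "d \<le> x" for x
    using powr_less_mono2[of \<alpha> d x] assms that by (cases "x = d") auto
  have eq: "A\<^sup>2 = D\<^sup>2 \<longleftrightarrow> a = d" "B\<^sup>2 = D\<^sup>2 \<longleftrightarrow> b = d"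
    using assms by (simp_all add: A_def B_def D_def powr_eq)
  have "exp (- \<alpha> * (ln a + ln b)) = 1 / (A * B)"
    using assms by (simp add: A_def B_def powr_def distrib_left exp_diff exp_minus inverse_eq_divide)
  moreover have "d powr (2 * \<alpha>) = D\<^sup>2"
    using assms by (simp add: D_def powr_power mult.commute)
  ultimately have l: "?l = (D\<^sup>2 + D\<^sup>2) / (A * B)"
    by simp
  have r: "?r = (A\<^sup>2 + B\<^sup>2) / (A * B)"
    using pos by (simp add: field_simps power2_eq_square flip: A_def B_def)
  show "?l \<le> ?r"
    unfolding l r using pos by (intro divide_right_mono add_mono le) auto
  have "?l = ?r \<longleftrightarrow> D\<^sup>2 + D\<^sup>2 = A\<^sup>2 + B\<^sup>2"
    unfolding l r using pos by simp
  then show "?l = ?r \<longleftrightarrow> a = d \<and> b = d"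
    using le eq by linarith
qed

theorem theorem5:
  fixes V :: "'a set" and E :: "'a set set" and \<alpha> :: real and m \<delta> :: nat
  assumes "simple_graph V E"
    and "m = card E" and "m \<ge> 1"
    and "\<delta> = min_degree V E"
    and "\<alpha> > 0"
  shows "SDD \<alpha> E \<ge> 2 * real \<delta> powr (2 * \<alpha>) * real m * real (NK_star V E) powr (- \<alpha> / real m)
    \<and> (SDD \<alpha> E = 2 * real \<delta> powr (2 * \<alpha>) * real m * real (NK_star V E) powr (- \<alpha> / real m)
          \<longleftrightarrow> regular_graph V E)"
proof -
  note G = assms(1)
  have finV: "finite V" and finE: "finite E"
    using G simple_graph_finite_edges by (auto simp: simple_graph_def)
  have neE: "E \<noteq> {}"
    using assms(2,3) by auto
  have regular: "regular_graph V E \<longleftrightarrow> (\<forall>u\<in>V. vdegree E u = \<delta>)"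
    using regular_graph_iff_min_degree[OF finV] assms(4) by simp
  have deg_ge: "\<delta> \<le> vdegree E u" if "u \<in> V" for u
    using min_degree_le[OF finV that] assms(4) by simp
  define S where "S = (\<lambda>e. \<Sum>u\<in>e. \<Sum>v\<in>e - {u}.
      real (vdegree E u) powr \<alpha> / real (vdegree E v) powr \<alpha>)"
  have SDD: "SDD \<alpha> E = sum S E"
    by (simp add: SDD_def S_def)
  have S_edge: "S {u, v} = real (vdegree E u) powr \<alpha> / real (vdegree E v) powr \<alpha>
      + real (vdegree E v) powr \<alpha> / real (vdegree E u) powr \<alpha>" if "u \<noteq> v" for u v
    unfolding S_def by (rule sdd_edge_term[OF that])
  show ?thesis
  proof (cases "\<delta> = 0")
    case True
    \<comment> \<open>Strict positivity also excludes equality, as the bound is \<open>0\<close>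
      here.\<close>
    have "0 < S e" if "e \<in> E" for e
    proof -
      from G that obtain u v where e: "e = {u, v}" "u \<noteq> v"
        by (rule simple_graph_edgeE)
      then have "0 < vdegree E u" "0 < vdegree E v"
        using that finE by (auto simp: vdegree_pos_iff)
      then show ?thesis
        by (simp add: e S_edge add_pos_pos)
    qed
    then have "0 < SDD \<alpha> E"
      unfolding SDD using finE neE by (intro sum_pos)
    moreover have "\<not> regular_graph V E"
    proof -
      from neE obtain e where "e \<in> E" by auto
      with G obtain u v where "e = {u, v}" "u \<in> V"
        by (rule simple_graph_edgeE)
      with \<open>e \<in> E\<close> have "0 < vdegree E u"
        using finE by (auto simp: vdegree_pos_iff)
      with \<open>u \<in> V\<close> show ?thesis
        using regular True by auto
    qed
    ultimately show ?thesis
      using True by simp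
  next
    case False
    then have \<delta>_pos: "0 < real \<delta>"
      by simp
    \<comment> \<open>For an edge \<open>uv\<close>, \<open>exp (- \<alpha> * y e)\<close> is
      \<open>(d_u d_v) powr (- \<alpha>)\<close>, so \<open>T\<close> is the edgewise lower bound
      that separates the two estimates.\<close>
    define y where "y = (\<lambda>e. \<Sum>u\<in>e. ln (real (vdegree E u)))"
    define T where "T = (\<lambda>e. 2 * real \<delta> powr (2 * \<alpha>) * exp (- \<alpha> * y e))"
    define R where "R = 2 * real \<delta> powr (2 * \<alpha>) * real m * real (NK_star V E) powr (- \<alpha> / real m)"
    have edge: "T e \<le> S e \<and> (T e = S e \<longleftrightarrow> (\<forall>u\<in>e. vdegree E u = \<delta>))" if "e \<in> E" for e
    proof -
      from G that obtain u v where e: "e = {u, v}" "u \<noteq> v" "u \<in> V" "v \<in> V"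
        by (rule simple_graph_edgeE)
      have "real \<delta> \<le> real (vdegree E u)" "real \<delta> \<le> real (vdegree E v)"
        using deg_ge e by auto
      from powr_ratio_sum_ge[OF \<delta>_pos this assms(5)] show ?thesis
        using e(2) by (simp add: e(1) S_edge T_def y_def)
    qed
    \<comment> \<open>Since \<open>ln (NK_star V E)\<close> is the sum of all \<open>y e\<close>,
      the power of \<open>NK_star\<close> is the exponential of the mean of
      \<open>- \<alpha> * y e\<close>.\<close>
    have R: "R = 2 * real \<delta> powr (2 * \<alpha>) * (real m * exp ((\<Sum>e\<in>E. - \<alpha> * y e) / real m))"
      using NK_star_pos[of V E] ln_NK_star[OF G]
      by (simp add: R_def powr_def y_def sum_negf flip: sum_distrib_left)
    have "R \<le> 2 * real \<delta> powr (2 * \<alpha>) * (\<Sum>e\<in>E. exp (- \<alpha> * y e))"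
      unfolding R assms(2)
      by (intro mult_left_mono sum_exp_ge_card_mult_exp_mean finE neE) auto
    then have RT: "R \<le> sum T E"
      by (simp add: T_def sum_distrib_left)
    have TS: "sum T E \<le> sum S E"
      using edge by (intro sum_mono) auto
    have "SDD \<alpha> E = R \<longleftrightarrow> regular_graph V E"
    proof
      assume "SDD \<alpha> E = R"
      then have "sum T E = sum S E"
        using RT TS SDD by simp
      \<comment> \<open>Equal sums with \<open>T \<le> S\<close> termwise force equality on every
        edge.\<close>
      then have "T e = S e" if "e \<in> E" for e
        using edge finE that sum_mono_inv[of T E S] by blast
      then have ends: "vdegree E u = \<delta>" if "e \<in> E" "u \<in> e" for e u
        using edge that by blast
      have "vdegree E u = \<delta>" if u: "u \<in> V" for u
      proof -
        have "0 < vdegree E u"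
          using deg_ge[OF u] False by simp
        then show ?thesis
          using ends finE by (auto simp: vdegree_pos_iff)
      qed
      then show "regular_graph V E"
        using regular by simp
    next
      assume "regular_graph V E"
      then have deg: "vdegree E u = \<delta>" if "u \<in> V" for u
        using regular that by simp
      \<comment> \<open>In the regular case both sides equal \<open>2 * m\<close>: each ratio is
        \<open>1\<close>, and the powers of \<open>\<delta>\<close> in \<open>R\<close>
        cancel.\<close>
      have S2: "S e = 2" and y2: "y e = 2 * ln (real \<delta>)" if "e \<in> E" for e
      proof -
        from G that obtain u v where e: "e = {u, v}" "u \<noteq> v" "u \<in> V" "v \<in> V"
          by (rule simple_graph_edgeE)
        then show "S e = 2" "y e = 2 * ln (real \<delta>)"
          using False by (simp_all add: S_edge deg y_def)
      qed
      have "(\<Sum>e\<in>E. - \<alpha> * y e) / real m = - (2 * \<alpha> * ln (real \<delta>))"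
        using assms(2,3) y2 by simp
      then have "R = 2 * real m"
        unfolding R using False by (simp add: powr_def exp_minus)
      then show "SDD \<alpha> E = R"
        using S2 assms(2) by (simp add: SDD)
    qed
    then show ?thesis
      using RT TS SDD unfolding R_def by auto
  qed
qed

end
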